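(* Let $p,q>1$, $r\in(0,1)$ and let $\lambda$ be a real number with $\lambda<\frac12$. Then $$K_{p,q}(r)=\frac{\pi_{p,q}}{2}\sum_{n=0}^\infty\binom{\frac1p-1}{n}\frac{1}{(1-\lambda)^{n+1-\frac1p}}\sum_{j=0}^n(-1)^j\binom{n}{j}\binom{-\frac1q}{j}\binom{\frac1p-1-\frac1q}{j}^{-1}\lambda^{n-j}r^{qj},$$ $$\hat{K}_{p,q}(r)=\frac{\pi_{p,q}}{2}\sum_{n=0}^\infty\binom{-\frac1p}{n}\frac{1}{(1-\lambda)^{n+\frac1p}}\sum_{j=0}^n(-1)^j\binom{n}{j}\binom{-\frac1q}{j}\binom{\frac1p-1-\frac1q}{j}^{-1}\lambda^{n-j}r^{qj},$$ $$E_{p,q}(r)=\frac{\pi_{p,q}}{2}\sum_{n=0}^\infty\binom{\frac1p}{n}\frac{1}{(1-\lambda)^{n-\frac1p}}\sum_{j=0}^n(-1)^j\binom{n}{j}\binom{-\frac1q}{j}\binom{\frac1p-1-\frac1q}{j}^{-1}\lambda^{n-j}r^{qj}.$$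
   Context: For $p,q>1$ and $r\in(0,1)$, define $$K_{p,q}(r)=\int_0^1\frac{dt}{(1-t^q)^{1/p}(1-r^qt^q)^{1-1/p}},\qquad \hat{K}_{p,q}(r)=\int_0^1\frac{dt}{(1-t^q)^{1/p}(1-r^qt^q)^{1/p}},$$ $$E_{p,q}(r)=\int_0^1\left(\frac{1-r^qt^q}{1-t^q}\right)^{1/p}dt,\qquad \pi_{p,q}=2\int_0^1(1-t^q)^{-1/p}\,dt=\frac2q B\left(1-\frac1p,\frac1q\right),$$ where $B$ is the beta function. For real $a$ and integer $n\ge0$, $\binom{a}{n}=\frac{a(a-1)\cdots(a-n+1)}{n!}$ is the generalized binomial coefficient (with $\binom a0=1$), and the convention $0^0=1$ is used for $\lambda^{n-j}$ when $\lambda=0$ and $j=n$. *)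

theory Defs
  imports "HOL-Analysis.Analysis"
begin

text \<open>
  The integrals are Henstock--Kurzweil integrals of nonnegative functions over the closed
  unit interval. The integrands are singular at \<open>t = 1\<close>, where they take the junk value
  \<open>0\<close> (from \<open>x / 0 = 0\<close> and \<open>0 powr a = 0\<close>); this single point does not affect the integral.
\<close>

definition K_pq :: "real \<Rightarrow> real \<Rightarrow> real \<Rightarrow> real" where
  "K_pq p q r = integral {0..1} (\<lambda>t.
     1 / ((1 - t powr q) powr (1/p) * (1 - r powr q * t powr q) powr (1 - 1/p)))"

definition K_hat_pq :: "real \<Rightarrow> real \<Rightarrow> real \<Rightarrow> real" where
  "K_hat_pq p q r = integral {0..1} (\<lambda>t.
     1 / ((1 - t powr q) powr (1/p) * (1 - r powr q * t powr q) powr (1/p)))"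

definition E_pq :: "real \<Rightarrow> real \<Rightarrow> real \<Rightarrow> real" where
  "E_pq p q r = integral {0..1} (\<lambda>t.
     ((1 - r powr q * t powr q) / (1 - t powr q)) powr (1/p))"

definition pi_pq :: "real \<Rightarrow> real \<Rightarrow> real" where
  "pi_pq p q = 2 * integral {0..1} (\<lambda>t. (1 - t powr q) powr (- 1/p))"

end

theory Submission
  imports Defs
begin

text \<open>
  All three integrands are the weight \<open>(1 - t\<^sup>q)\<^sup>-\<^sup>1\<^sup>/\<^sup>p\<close> times \<open>(1 - x)\<^sup>a\<close> with \<open>x = r\<^sup>q t\<^sup>q\<close> in
  \<open>[0, r\<^sup>q]\<close>. Since \<open>l < 1/2\<close>, the quotient \<open>\<bar>l - x\<bar> / (1 - l)\<close> is bounded away from \<open>1\<close> there, so the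
  binomial series of \<open>((1 - l) + (l - x))\<^sup>a\<close> converges uniformly and may be integrated termwise.
  Expanding \<open>(l - x)\<^sup>n\<close> leaves the moments of the weight; they satisfy a first-order recurrence
  obtained by integrating the derivative of \<open>t\<^sup>1\<^sup>+\<^sup>q\<^sup>j (1 - t\<^sup>q)\<^sup>1\<^sup>-\<^sup>1\<^sup>/\<^sup>p\<close>.
\<close>

section \<open>Integrability and positivity of the weight\<close>

text \<open>The antiderivative \<open>- ((1 - t) powr (1 - b)) / (1 - b)\<close> stays continuous at
  the singular endpoint because \<open>1 - b\<close> is positive. This function serves as the
  majorant for every integrand below.\<close>

lemma one_minus_powr_integrable:
  fixes b :: real
  assumes "b < 1"
  shows "(\<lambda>t. (1 - t) powr (- b)) integrable_on {0..1}"
proof -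
  have "((\<lambda>t. (1 - t) powr (- b)) has_integral
          ((\<lambda>t. - ((1 - t) powr (1 - b)) / (1 - b)) 1 - (\<lambda>t. - ((1 - t) powr (1 - b)) / (1 - b)) 0)) {0..1}"
  proof (rule fundamental_theorem_of_calculus_interior)
    show "continuous_on {0..1} (\<lambda>t. - ((1 - t) powr (1 - b)) / (1 - b))"
      using assms by (intro continuous_intros continuous_on_powr') auto
    fix x :: real assume x: "x \<in> {0<..<1}"
    have "((\<lambda>t. 1 - t) has_field_derivative -1) (at x)"
      by (auto intro!: derivative_eq_intros)
    then have "((\<lambda>t. (1 - t) powr (1 - b)) has_field_derivative - ((1 - b) * (1 - x) powr (- b))) (at x)"
      using x DERIV_fun_powr[of "\<lambda>t. 1 - t" "-1" x "1 - b"] by simp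
    then have "((\<lambda>t. - ((1 - t) powr (1 - b)) / (1 - b)) has_field_derivative (1 - x) powr (- b)) (at x)"
      using assms DERIV_cdivide[OF DERIV_minus, of "\<lambda>t. (1 - t) powr (1 - b)" _ x _ "1 - b"]
      by fastforce
    then show "((\<lambda>t. - ((1 - t) powr (1 - b)) / (1 - b)) has_vector_derivative (1 - x) powr (- b)) (at x)"
      by (simp add: has_real_derivative_iff_has_vector_derivative)
  qed simp
  then show ?thesis by blast
qed

lemma powr_le_self:
  fixes t q :: real
  assumes "0 \<le> t" "t \<le> 1" "1 \<le> q"
  shows "t powr q \<le> t"
  using powr_mono'[of 1 q t] assms by simp

text \<open>As \<open>q\<close> is at least 1, \<open>t powr q\<close> lies below \<open>t\<close>
  on the unit interval, so the weight is dominated by \<open>(1 - t) powr (- b)\<close>, whose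
  exponent is nonpositive; the bounded measurable factor \<open>g\<close> only costs a
  constant.\<close>

lemma weight_mult_integrable:
  fixes b q C :: real
  assumes b: "0 \<le> b" "b < 1" and q: "1 \<le> q"
    and g: "g \<in> borel_measurable borel" and C: "\<And>t. t \<in> {0..1} \<Longrightarrow> \<bar>g t\<bar> \<le> C"
  shows "(\<lambda>t. (1 - t powr q) powr (- b) * g t) integrable_on {0..1}"
proof -
  have "(\<lambda>t. (1 - t powr q) powr (- b) * g t) absolutely_integrable_on {0..1}"
  proof (rule measurable_bounded_by_integrable_imp_absolutely_integrable)
    have "(\<lambda>t. (1 - t powr q) powr (- b) * g t) \<in> borel_measurable lborel"
      using g by simp
    then show "(\<lambda>t. (1 - t powr q) powr (- b) * g t) \<in> borel_measurable (lebesgue_on {0..1})"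
      by (intro measurable_restrict_space1 measurable_completion)
    show "(\<lambda>t. (1 - t) powr (- b) * C) integrable_on {0..1}"
      by (rule integrable_on_mult_left[OF one_minus_powr_integrable[OF b(2)]])
    fix t :: real assume t: "t \<in> {0..1}"
    have "(1 - t powr q) powr (- b) \<le> (1 - t) powr (- b)"
    \<comment> \<open>Antitonicity of the power needs a positive base. At \<open>t = 1\<close> both
      sides take the default value \<open>0 powr (- b) = 0\<close>.\<close>
    proof (cases "t = 1")
      case False
      then show ?thesis
        using powr_le_self[of t q] q t b by (intro powr_mono2') auto
    qed simp
    then show "norm ((1 - t powr q) powr (- b) * g t) \<le> (1 - t) powr (- b) * C"
      using C[OF t] by (auto simp: abs_mult intro!: mult_mono)
  qed simp
  then show ?thesis
    by (rule set_lebesgue_integral_eq_integral(1))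
qed

lemma weight_integrable:
  fixes b q :: real
  assumes "0 \<le> b" "b < 1" "1 \<le> q"
  shows "(\<lambda>t. (1 - t powr q) powr (- b)) integrable_on {0..1}"
  using weight_mult_integrable[of b q "\<lambda>_. 1" 1] assms by simp

lemma weight_moment_integrable:
  fixes b q :: real
  assumes "0 \<le> b" "b < 1" "1 \<le> q"
  shows "(\<lambda>t. (1 - t powr q) powr (- b) * (t powr q) ^ j) integrable_on {0..1}"
proof (rule weight_mult_integrable[OF assms])
  show "\<bar>(t powr q) ^ j\<bar> \<le> 1" if "t \<in> {0..1}" for t
    using that assms powr_le_self[of t q] by (auto simp: power_abs intro!: power_le_one)
qed simp

text \<open>Needed later to divide by \<open>pi_pq p q / 2\<close> when deducing summability of the
  unscaled series.\<close>

lemma weight_integral_pos: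
  fixes b q :: real
  assumes "0 \<le> b" "b < 1" "1 \<le> q"
  shows "0 < integral {0..1} (\<lambda>t. (1 - t powr q) powr (- b))"
proof -
  \<comment> \<open>The constant 1 is a lower bound only for \<open>t < 1\<close>, since the weight
    has the default value 0 at \<open>t = 1\<close>; the function \<open>1 - t\<close> is a lower
    bound on the whole interval.\<close>
  have "((\<lambda>t::real. 1 - t) has_integral 1/2) {0..1}"
    using has_integral_diff[OF has_integral_const_real[of 1 0 1] ident_has_integral[of 0 "1::real"]] by simp
  moreover have "((\<lambda>t. (1 - t powr q) powr (- b)) has_integral
      integral {0..1} (\<lambda>t. (1 - t powr q) powr (- b))) {0..1}"
    using weight_integrable[OF assms] by (rule integrable_integral)
  moreover have "1 - t \<le> (1 - t powr q) powr (- b)" if t: "t \<in> {0..1}" for t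
  proof (cases "t = 1")
    case False
    then have "1 - t powr q > 0" "1 - t powr q \<le> 1"
      using t powr_le_self[of t q] assms by auto
    then have "1 powr (- b) \<le> (1 - t powr q) powr (- b)"
      using assms by (intro powr_mono2') auto
    then show ?thesis using t by auto
  qed simp
  ultimately have "1/2 \<le> integral {0..1} (\<lambda>t. (1 - t powr q) powr (- b))"
    by (rule has_integral_le)
  then show ?thesis by simp
qed

section \<open>Moments of the weight\<close>

text \<open>The function \<open>?F\<close> vanishes at both endpoints, so its derivative has
  integral zero. Splitting one factor \<open>1 - t powr q\<close> off its power writes that
  derivative as a combination of the integrands of moments \<open>j\<close> and
  \<open>Suc j\<close>.\<close>

lemma weight_moment_Suc:
  fixes b q :: real
  assumes "0 \<le> b" "b < 1" "1 \<le> q"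
  shows "(1 + q * j + q * (1 - b)) * integral {0..1} (\<lambda>t. (1 - t powr q) powr (- b) * (t powr q) ^ Suc j)
       = (1 + q * j) * integral {0..1} (\<lambda>t. (1 - t powr q) powr (- b) * (t powr q) ^ j)"
proof -
  let ?F = "\<lambda>t. t powr (1 + q * j) * (1 - t powr q) powr (1 - b)"
  let ?m = "\<lambda>j t. (1 - t powr q) powr (- b) * (t powr q) ^ j"
  let ?f = "\<lambda>t. (1 + q * j) * ?m j t - (1 + q * j + q * (1 - b)) * ?m (Suc j) t"
  have "(?f has_integral (?F 1 - ?F 0)) {0..1}"
  proof (rule fundamental_theorem_of_calculus_interior)
    \<comment> \<open>Positivity of both exponents, \<open>1 + q * j\<close> and
      \<open>1 - b\<close>, makes \<open>?F\<close> continuous up to the endpoints, where it need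
      not be differentiable.\<close>
    have "0 < 1 + q * j" using assms by (intro add_pos_nonneg) auto
    moreover have "0 \<le> 1 - t powr q" if "t \<in> {0..1}" for t
      using that assms powr_le_self[of t q] by auto
    ultimately show "continuous_on {0..1} ?F"
      using assms
      by (intro continuous_on_mult continuous_on_powr' continuous_on_diff continuous_on_const
          continuous_on_id) simp_all
    fix t :: real assume t: "t \<in> {0<..<1}"
    then have x: "t powr q < 1" using powr_le_self[of t q] assms by auto
    have e: "t powr (q * j) = (t powr q) ^ j"
      using t by (simp add: powr_powr flip: powr_realpow)
    have e2: "(1 - t powr q) powr (1 - b) = (1 - t powr q) * (1 - t powr q) powr (- b)"
      using x by (simp add: powr_diff powr_minus field_simps)
    have e3: "t powr (1 + q * j) = t * (t powr q) ^ j" "t * t powr (q - 1) = t powr q"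
      using t e by (simp_all add: powr_add powr_diff)
    have dx: "((\<lambda>t. t powr s) has_field_derivative s * t powr (s - 1)) (at t)" for s
      using t by (intro has_real_derivative_powr) auto
    have "((\<lambda>t. 1 - t powr q) has_field_derivative - (q * t powr (q - 1))) (at t)"
      using DERIV_diff[OF DERIV_const dx, of 1 q] by simp
    from DERIV_fun_powr[OF this, of "1 - b"] x
    have dy: "((\<lambda>t. (1 - t powr q) powr (1 - b)) has_field_derivative
        - ((1 - b) * (1 - t powr q) powr (- b) * (q * t powr (q - 1)))) (at t)"
      by (simp add: mult_ac)
    have "(?F has_field_derivative
        (1 + q * j) * t powr (q * j) * (1 - t powr q) powr (1 - b)
        - t powr (1 + q * j) * ((1 - b) * (1 - t powr q) powr (- b) * (q * t powr (q - 1)))) (at t)"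
      using DERIV_mult[OF dx[of "1 + q * j"] dy] by (simp add: algebra_simps)
    also have "(1 + q * j) * t powr (q * j) * (1 - t powr q) powr (1 - b)
        - t powr (1 + q * j) * ((1 - b) * (1 - t powr q) powr (- b) * (q * t powr (q - 1)))
        = (1 + q * j) * t powr (q * j) * (1 - t powr q) powr (1 - b)
        - (t * t powr (q - 1)) * (t powr q) ^ j * ((1 - b) * (1 - t powr q) powr (- b) * q)"
      by (simp only: e3(1) mult_ac)
    also have "\<dots> = ?f t"
      unfolding e e2 e3(2) by (simp add: algebra_simps)
    finally show "(?F has_vector_derivative ?f t) (at t)"
      by (simp add: has_real_derivative_iff_has_vector_derivative)
  qed simp
  then have "integral {0..1} ?f = 0"
    using assms by (simp add: integral_unique)
  moreover have "integral {0..1} ?f = (1 + q * j) * integral {0..1} (?m j)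
      - (1 + q * j + q * (1 - b)) * integral {0..1} (?m (Suc j))"
    using weight_moment_integrable[OF assms, of j] weight_moment_integrable[OF assms, of "Suc j"]
    by (subst integral_diff) (auto intro!: integrable_on_mult_right simp del: power_Suc)
  ultimately show ?thesis by simp
qed

text \<open>The quotient of the binomial coefficients is 1 at \<open>j = 0\<close>, and each step
  multiplies it by \<open>(- 1/q - j) / (b - 1 - 1/q - j)\<close>, which is the factor in the moment
  recurrence. The lower coefficient never vanishes, as \<open>b - 1 - 1/q\<close> is
  negative.\<close>

lemma weight_moment:
  fixes b q :: real
  assumes "0 \<le> b" "b < 1" "1 \<le> q"
  shows "integral {0..1} (\<lambda>t. (1 - t powr q) powr (- b) * (t powr q) ^ j)
       = integral {0..1} (\<lambda>t. (1 - t powr q) powr (- b))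
         * (((- 1/q) gchoose j) * inverse ((b - 1 - 1/q) gchoose j))"
proof (induction j)
  case (Suc j)
  have q: "q > 0" using assms by simp
  have d: "1 + q * j + q * (1 - b) > 0"
    using assms by (intro add_pos_nonneg) auto
  have S: "x gchoose Suc j = (x gchoose j) * ((x - j) / (1 + real j))" for x :: real
    using gbinomial_absorb_comp[of x j] gbinomial_absorption[of j x]
    by (simp add: field_simps)
  have r: "(- 1/q - j) / (1 + real j) * inverse ((b - 1 - 1/q - j) / (1 + real j))
      = (1 + q * j) / (1 + q * j + q * (1 - b))"
  proof -
    have "- 1/q - j = - ((1 + q * j) / q)" "b - 1 - 1/q - j = - ((1 + q * j + q * (1 - b)) / q)"
      using q by (simp_all add: field_simps)
    moreover have "- (X / q) / k * inverse (- (Y / q) / k) = X / Y" if "k \<noteq> 0" "Y \<noteq> 0" for X Y k :: real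
      using that q by (simp add: field_simps)
    ultimately show ?thesis
      using d by (metis add_pos_nonneg less_irrefl of_nat_0_le_iff zero_less_one)
  qed
  have "integral {0..1} (\<lambda>t. (1 - t powr q) powr (- b) * (t powr q) ^ Suc j)
      = integral {0..1} (\<lambda>t. (1 - t powr q) powr (- b) * (t powr q) ^ j)
        * ((1 + q * j) / (1 + q * j + q * (1 - b)))"
    using weight_moment_Suc[OF assms, of j] d by (simp add: field_simps del: power_Suc)
  then show ?case
    unfolding Suc.IH S r[symmetric] by (simp only: inverse_mult_distrib mult_ac)
qed simp

section \<open>Termwise integration of the binomial series\<close>

lemma weight_integral_sums:
  fixes b q r l a :: real
  assumes b: "0 \<le> b" "b < 1" and q: "1 \<le> q" and r: "0 < r" "r < 1" and l: "l < 1/2"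
  defines "c \<equiv> \<lambda>n. (a gchoose n) * (1 - l) powr (a - real n)
            * (\<Sum>j\<le>n. (-1) ^ j * real (n choose j) * ((- 1/q) gchoose j)
               * inverse ((b - 1 - 1/q) gchoose j) * l ^ (n - j) * r powr (q * real j))"
  shows "(\<lambda>n. integral {0..1} (\<lambda>t. (1 - t powr q) powr (- b)) * c n) sums
     integral {0..1} (\<lambda>t. (1 - t powr q) powr (- b) * (1 - r powr q * t powr q) powr a)"
proof -
  define w where "w = (\<lambda>t. (1 - t powr q) powr (- b))"
  define T where "T = (\<lambda>n t. (a gchoose n) * (l - r powr q * t powr q) ^ n * (1 - l) powr (a - real n))"
  \<comment> \<open>The distance from \<open>l\<close> to a point of \<open>[0, r powr q]\<close> is
    largest at an endpoint. Division by \<open>1 - l\<close> gives a ratio below 1: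
    \<open>l < 1/2\<close> handles the endpoint 0, and \<open>r powr q < 1\<close> together with
    \<open>l < 1/2\<close> handles the other.\<close>
  define \<rho> where "\<rho> = max \<bar>l\<bar> \<bar>l - r powr q\<bar> / (1 - l)"
  \<comment> \<open>A majorant of \<open>T n t\<close> independent of \<open>t\<close>, summable
    because \<rho> lies inside the radius of convergence of the binomial series.\<close>
  define B where "B = (\<lambda>n. \<bar>(a gchoose n) * \<rho> ^ n\<bar> * (1 - l) powr a)"
  have rq: "0 < r powr q" "r powr q < 1"
    using r q powr_le_self[of r q] by auto
  have \<rho>: "0 \<le> \<rho>" "\<rho> < 1"
  proof -
    have "max \<bar>l\<bar> \<bar>l - r powr q\<bar> < 1 - l"
      using l rq by linarith
    then show "0 \<le> \<rho>" "\<rho> < 1"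
      using l by (simp_all add: \<rho>_def)
  qed
  have x: "0 \<le> r powr q * t powr q" "r powr q * t powr q \<le> r powr q" if "t \<in> {0..1}" for t
    using that q rq powr_le_self[of t q] by (auto intro!: mult_left_le)
  have B: "summable B"
    unfolding B_def
    using abs_summable_in_conv_radius[of \<rho> "\<lambda>n. a gchoose n"] \<rho>
    by (intro summable_mult2) (simp add: conv_radius_gchoose)
  have TB: "\<bar>T n t\<bar> \<le> B n" if t: "t \<in> {0..1}" for n t
  proof -
    have "\<bar>l - r powr q * t powr q\<bar> \<le> max \<bar>l\<bar> \<bar>l - r powr q\<bar>"
      using x[OF t] by linarith
    then have "\<bar>l - r powr q * t powr q\<bar> \<le> \<rho> * (1 - l)"
      using l by (simp add: \<rho>_def)
    then have "\<bar>l - r powr q * t powr q\<bar> ^ n \<le> (\<rho> * (1 - l)) ^ n"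
      by (intro power_mono) auto
    then have "\<bar>T n t\<bar> \<le> \<bar>a gchoose n\<bar> * (\<rho> * (1 - l)) ^ n * (1 - l) powr (a - real n)"
      by (auto simp: T_def abs_mult power_abs intro!: mult_right_mono mult_left_mono)
    also have "\<dots> = B n"
      using l \<rho> by (simp add: B_def abs_mult power_mult_distrib powr_diff powr_realpow)
    finally show ?thesis .
  qed
  have Tsums: "(\<lambda>n. T n t) sums (1 - r powr q * t powr q) powr a" if t: "t \<in> {0..1}" for t
    \<comment> \<open>The two summands add up to \<open>1 - r powr q * t powr q\<close>, so the
      limit is independent of \<open>l\<close>.\<close>
    using gen_binomial_real'[of "l - r powr q * t powr q" "1 - l" a] x[OF t] l rq
    by (simp add: T_def abs_less_iff)
  have w0: "0 \<le> w t" for t by (simp add: w_def)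
  have wint: "(\<lambda>t. w t * (t powr q) ^ j) integrable_on {0..1}" for j
    unfolding w_def by (rule weight_moment_integrable[OF b q])
  have wT: "((\<lambda>t. w t * T n t) has_integral (integral {0..1} w * c n)) {0..1}" for n
  proof -
    \<comment> \<open>The coefficient of the \<open>j\<close>-th moment after expanding the
      \<open>n\<close>-th power. For \<open>l = 0\<close> only \<open>j = n\<close> survives,
      through \<open>0 ^ 0 = 1\<close>.\<close>
    define d where "d = (\<lambda>j. (a gchoose n) * (1 - l) powr (a - real n)
      * ((-1) ^ j * real (n choose j) * l ^ (n - j) * (r powr q) ^ j))"
    have "w t * T n t = (\<Sum>j\<le>n. d j * (w t * (t powr q) ^ j))" for t
    proof -
      have "(l - r powr q * t powr q) ^ n = (\<Sum>j\<le>n. real (n choose j) * (- (r powr q * t powr q)) ^ j * l ^ (n - j))"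
        using binomial_ring[of "- (r powr q * t powr q)" l n] by simp
      also have "\<dots> = (\<Sum>j\<le>n. (-1) ^ j * real (n choose j) * l ^ (n - j) * (r powr q) ^ j * (t powr q) ^ j)"
        by (intro sum.cong refl) (simp add: power_mult_distrib power_minus[of "_ * _"] mult_ac)
      finally show ?thesis
        by (simp add: T_def d_def sum_distrib_left sum_distrib_right mult_ac)
    qed
    moreover have "((\<lambda>t. \<Sum>j\<le>n. d j * (w t * (t powr q) ^ j)) has_integral
       (\<Sum>j\<le>n. d j * integral {0..1} (\<lambda>t. w t * (t powr q) ^ j))) {0..1}"
      by (intro has_integral_sum has_integral_mult_right integrable_integral wint) auto
    moreover have "(\<Sum>j\<le>n. d j * integral {0..1} (\<lambda>t. w t * (t powr q) ^ j)) = integral {0..1} w * c n"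
    proof -
      have "(r powr q) ^ j = r powr (q * real j)" for j
        using r by (simp add: powr_powr flip: powr_realpow)
      then show ?thesis
        unfolding c_def d_def w_def weight_moment[OF b q] 
        by (simp add: sum_distrib_left sum_distrib_right mult_ac)
    qed
    ultimately show ?thesis by simp
  qed
  have wS: "((\<lambda>t. \<Sum>n<k. w t * T n t) has_integral (\<Sum>n<k. integral {0..1} w * c n)) {0..1}" for k
    by (intro has_integral_sum wT) auto
  have "(\<lambda>k. integral {0..1} (\<lambda>t. \<Sum>n<k. w t * T n t))
      \<longlonglongrightarrow> integral {0..1} (\<lambda>t. w t * (1 - r powr q * t powr q) powr a)"
  proof (rule dominated_convergence(2))
    show "(\<lambda>t. \<Sum>n<k. w t * T n t) integrable_on {0..1}" for k
      using wS by blast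
    \<comment> \<open>The partial sums of \<open>T\<close> are bounded by \<open>suminf B\<close>
      uniformly in \<open>t\<close>; since the weight may be unbounded, the dominating function
      keeps the factor \<open>w\<close>, whose integrability is that of the zeroth moment.\<close>
    show "(\<lambda>t. w t * suminf B) integrable_on {0..1}"
      using wint[of 0] by (intro integrable_on_mult_left) simp
    fix t :: real assume t: "t \<in> {0..1}"
    show "(\<lambda>k. \<Sum>n<k. w t * T n t) \<longlonglongrightarrow> w t * (1 - r powr q * t powr q) powr a"
      using sums_mult[OF Tsums[OF t], of "w t"] by (simp add: sums_def)
    fix k
    have "\<bar>\<Sum>n<k. T n t\<bar> \<le> (\<Sum>n<k. B n)"
      using TB[OF t] by (intro order_trans[OF sum_abs] sum_mono)
    also have "\<dots> \<le> suminf B"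
      using B by (intro sum_le_suminf) (auto simp: B_def)
    finally show "norm (\<Sum>n<k. w t * T n t) \<le> w t * suminf B"
      using w0[of t] by (simp add: abs_mult mult_left_mono flip: sum_distrib_left)
  qed
  then show ?thesis
    unfolding sums_def integral_unique[OF wS] unfolding w_def .
qed

section \<open>The three expansions\<close>

text \<open>A common template for the three claims: \<open>F\<close> stands for the elliptic
  integral, \<open>a\<close> for its exponent, and \<open>e n\<close> for whichever form of
  \<open>real n - a\<close> the claim displays in the denominator.\<close>

lemma weight_integral_series:
  fixes p q r l a :: real
  assumes "p > 1" "q > 1" "0 < r" "r < 1" "l < 1/2"
    and e: "\<And>n::nat. (1 - l) powr (a - real n) = 1 / (1 - l) powr e n"
    and F: "F = integral {0..1} (\<lambda>t. (1 - t powr q) powr (- (1/p)) * (1 - r powr q * t powr q) powr a)"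
  shows "let s = (\<lambda>n. (a gchoose n) * (1 / (1 - l) powr e n)
            * (\<Sum>j\<le>n. (-1) ^ j * real (n choose j) * ((- 1/q) gchoose j)
               * inverse ((1/p - 1 - 1/q) gchoose j) * l ^ (n - j) * r powr (q * real j)))
     in summable s \<and> F = pi_pq p q / 2 * (\<Sum>n. s n)"
proof -
  define s where "s = (\<lambda>n. (a gchoose n) * (1 / (1 - l) powr e n)
            * (\<Sum>j\<le>n. (-1) ^ j * real (n choose j) * ((- 1/q) gchoose j)
               * inverse ((1/p - 1 - 1/q) gchoose j) * l ^ (n - j) * r powr (q * real j)))"
  have p: "0 \<le> 1/p" "1/p < 1" "1 \<le> q" using assms by auto
  have pi: "pi_pq p q / 2 = integral {0..1} (\<lambda>t. (1 - t powr q) powr (- (1/p)))"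
    by (simp add: pi_pq_def)
  have pos: "pi_pq p q / 2 > 0"
    unfolding pi by (rule weight_integral_pos[OF p])
  have S: "(\<lambda>n. pi_pq p q / 2 * s n) sums F"
    using weight_integral_sums[OF p, of r l a] assms(3-5) unfolding F pi s_def e by simp
  have "summable s"
    using sums_summable[OF S] pos by simp
  moreover have "F = pi_pq p q / 2 * suminf s"
    using sums_unique[OF S] suminf_mult[OF \<open>summable s\<close>, of "pi_pq p q / 2"] by simp
  ultimately show ?thesis by (simp add: s_def)
qed

theorem theorem2p9:
  fixes p q r l :: real
  assumes "p > 1" and "q > 1" and "0 < r" and "r < 1" and "l < 1/2"
  shows "(let a = (\<lambda>n. ((1/p - 1) gchoose n) * (1 / (1 - l) powr (real n + 1 - 1/p))
            * (\<Sum>j\<le>n. (-1) ^ j * real (n choose j) * ((- 1/q) gchoose j)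
               * inverse ((1/p - 1 - 1/q) gchoose j) * l ^ (n - j) * r powr (q * real j)))
     in summable a \<and> K_pq p q r = pi_pq p q / 2 * (\<Sum>n. a n))
       \<and> (let a = (\<lambda>n. ((- 1/p) gchoose n) * (1 / (1 - l) powr (real n + 1/p))
            * (\<Sum>j\<le>n. (-1) ^ j * real (n choose j) * ((- 1/q) gchoose j)
               * inverse ((1/p - 1 - 1/q) gchoose j) * l ^ (n - j) * r powr (q * real j)))
     in summable a \<and> K_hat_pq p q r = pi_pq p q / 2 * (\<Sum>n. a n))
       \<and> (let a = (\<lambda>n. ((1/p) gchoose n) * (1 / (1 - l) powr (real n - 1/p))
            * (\<Sum>j\<le>n. (-1) ^ j * real (n choose j) * ((- 1/q) gchoose j)
               * inverse ((1/p - 1 - 1/q) gchoose j) * l ^ (n - j) * r powr (q * real j)))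
     in summable a \<and> E_pq p q r = pi_pq p q / 2 * (\<Sum>n. a n))"
proof (intro conjI)
  \<comment> \<open>These bounds make numerator and denominator in \<open>E_pq\<close> nonnegative,
    so that the power of the quotient splits.\<close>
  have x: "r powr q * t powr q \<le> 1" "t powr q \<le> 1" if "t \<in> {0..1}" for t
    using that assms powr_le_self[of t q] powr_le_self[of r q] by (auto intro!: mult_le_one)
  show "let a = (\<lambda>n. ((1/p - 1) gchoose n) * (1 / (1 - l) powr (real n + 1 - 1/p))
            * (\<Sum>j\<le>n. (-1) ^ j * real (n choose j) * ((- 1/q) gchoose j)
               * inverse ((1/p - 1 - 1/q) gchoose j) * l ^ (n - j) * r powr (q * real j)))
     in summable a \<and> K_pq p q r = pi_pq p q / 2 * (\<Sum>n. a n)"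
  proof (rule weight_integral_series[OF assms])
    show "K_pq p q r = integral {0..1} (\<lambda>t. (1 - t powr q) powr (- (1/p)) * (1 - r powr q * t powr q) powr (1/p - 1))"
      unfolding K_pq_def
    proof (intro integral_cong)
      fix t :: real
      show "1 / ((1 - t powr q) powr (1/p) * (1 - r powr q * t powr q) powr (1 - 1/p))
          = (1 - t powr q) powr (- (1/p)) * (1 - r powr q * t powr q) powr (1/p - 1)"
        using powr_minus_divide[of "1 - t powr q" "1/p"]
          powr_minus_divide[of "1 - r powr q * t powr q" "1 - 1/p"] by simp
    qed
  qed (simp add: algebra_simps flip: powr_minus_divide)
  show "let a = (\<lambda>n. ((- 1/p) gchoose n) * (1 / (1 - l) powr (real n + 1/p))
            * (\<Sum>j\<le>n. (-1) ^ j * real (n choose j) * ((- 1/q) gchoose j)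
               * inverse ((1/p - 1 - 1/q) gchoose j) * l ^ (n - j) * r powr (q * real j)))
     in summable a \<and> K_hat_pq p q r = pi_pq p q / 2 * (\<Sum>n. a n)"
  proof (rule weight_integral_series[OF assms])
    show "K_hat_pq p q r = integral {0..1} (\<lambda>t. (1 - t powr q) powr (- (1/p)) * (1 - r powr q * t powr q) powr (- 1/p))"
      unfolding K_hat_pq_def by (intro integral_cong) (simp add: powr_minus_divide)
    fix n :: nat
    have "- 1/p - real n = - (real n + 1/p)" by simp
    then show "(1 - l) powr (- 1/p - real n) = 1 / (1 - l) powr (real n + 1/p)"
      by (simp only: powr_minus_divide)
  qed
  show "let a = (\<lambda>n. ((1/p) gchoose n) * (1 / (1 - l) powr (real n - 1/p))
            * (\<Sum>j\<le>n. (-1) ^ j * real (n choose j) * ((- 1/q) gchoose j)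
               * inverse ((1/p - 1 - 1/q) gchoose j) * l ^ (n - j) * r powr (q * real j)))
     in summable a \<and> E_pq p q r = pi_pq p q / 2 * (\<Sum>n. a n)"
  proof (rule weight_integral_series[OF assms])
    show "E_pq p q r = integral {0..1} (\<lambda>t. (1 - t powr q) powr (- (1/p)) * (1 - r powr q * t powr q) powr (1/p))"
      unfolding E_pq_def using x by (intro integral_cong) (simp add: powr_divide powr_minus_divide)
  qed (simp add: algebra_simps flip: powr_minus_divide)
qed

end
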